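(* Let $(\mathcal{B}_t,\mathcal{L}_t,\mathbf{P})$ be a market for liquidity at time $t$ with strict preferences (lenders charge no risk premium and prefer safer borrowers). Given a net exposure matrix $\bar A_{t-1}$ at time $t-1$, let $\bar A^{*,\mathcal{T}}_t$, $\bar A^{*,\kappa}_t$ and $\bar A^*_t$ be the net exposure matrices formed at time $t$ with a systemic risk tax matrix $\mathcal{T}$, with a Tobin-like tax $\kappa\ge0$, and without tax by the unique equilibrium (stable) matchings $\mu^{*,\mathcal{T}}_t$, $\mu^{*,\kappa}_t$ and $\mu^*_t$, respectively. Then: (i) If $\mathrm{Vol}(\mu^*_t)=\nu$, there exists $\mathcal{T}$ such that $ESL(\bar A^{*,\mathcal{T}}_t,\vec E_t)\le ESL(\bar A^*_t,\vec E_t)$ and $\mathrm{Vol}(\mu^{*,\mathcal{T}}_t)\ge\mathrm{Vol}(\mu^*_t)$. In particular, there exists $\mathcal{T}$ such that $\mu^{*,\mathcal{T}}_t$ is systemic risk-efficient (for the volume $\nu$). (ii) If $\mathrm{Vol}(\mu^{*,\kappa}_t)=\nu$, there exists $\mathcal{T}$ such that $ESL(\bar A^{*,\mathcal{T}}_t,\vec E_t)\le ESL(\bar A^{*,\kappa}_t,\vec E_t)$ and $\mathrm{Vol}(\mu^{*,\mathcal{T}}_t)\ge\mathrm{Vol}(\mu^{*,\kappa}_t)$.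
   Context: **Market.** $\mathcal{N}=\{1,\dots,n\}$ is a finite set of banks; $\mathcal{L}_t,\mathcal{B}_t\subseteq\mathcal{N}$ are disjoint sets (potential lenders and potential borrowers); $\mathbf{P}$ is the collection of all preference lists described below. Each lender $i$ has a lending rate $r_i$, charged to any borrower (no risk premium). Each borrower $j$ has a reservation rate $\bar r_j$ and a default probability $\rho_j$. Under a systemic risk tax $\mathcal{T}=(\tau_{ij})_{i\in\mathcal{L}_t,j\in\mathcal{B}_t}$, $\tau_{ij}\ge0$, the rate paid by $j$ to borrow from $i$ is $r^{\mathcal{T}}_{ij}=r_i+\tau_{ij}$; under a Tobin-like tax $\kappa$ it is $r^\kappa_{ij}=r_i+\kappa$. Reservation rates and lenders' preferences do not change under taxes. **Preferences.** Borrower $j$ prefers an option with a lower rate (rates of the relevant taxed or untaxed market), where the option "stay unmatched" (denoted $j$) has rate $\bar r_j$. Every lender prefers borrowers with lower default probability. "Strict preferences" means that there are no ties in these preference lists; in particular the $r_i$ are pairwise distinct and the $\rho_j$ are pairwise distinct. **Matching.** A matching $\mu_t$ is a one-to-one correspondence from $\mathcal{N}$ onto itself with $\mu_t(\mu_t(a))=a$ for all $a$, such that for any $b\in\mathcal{B}_t$, if $\mu_t(b)\neq b$ then $\mu_t(b)\in\mathcal{L}_t$, and for any $l\in\mathcal{L}_t$, if $\mu_t(l)\neq l$ then $\mu_t(l)\in\mathcal{B}_t$. A bank $a$ with $\mu_t(a)=a$ is unmatched. The volume is $\mathrm{Vol}(\mu_t)=\frac12\sum_{i\in\mathcal{L}_t\cup\mathcal{B}_t}\mathbf{1}\{\mu_t(i)\neq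 i\}$. **Stable matching.** A matching $\mu^*$ is stable if: (I) (pairwise deviation) for all $i,l\in\mathcal{L}_t$ and $k,j\in\mathcal{B}_t$ such that $\mu^*(i)=j$ and $\mu^*(k)=l$, it cannot be that both $i$ strictly prefers $k$ to $j$ and $k$ strictly prefers $i$ to $l$; (II) (coalitional deviation) let $\vec b\subseteq\mathcal{B}_t$ be a set of borrowers such that their assigned lenders are indifferent between any borrowers in $\vec b$ (for any $j,k\in\vec b$, lender $\mu^*(j)$ is indifferent between $j$ and $k$); then there cannot be another matching $\mu'$ such that every $j\in\vec b$ strictly prefers $\mu'(j)$ to $\mu^*(j)$ (this condition expresses that no group of borrowing banks can agree to swap counter-parties if their lenders are indifferent; it is regarded as not applying when lenders' preferences are strict); (III) (unilateral deviation) for any $j\in\mathcal{B}_t$ with $\mu^*(j)\neq j$, it cannot be that $j$ strictly prefers staying unmatched to $\mu^*(j)$; and for any $j\in\mathcal{B}_t$, it cannot be that $j$ strictly prefers to $\mu^*(j)$ some $k\in\mathcal{L}_t$ with $\mu^*(k)=k$. **Net exposures.** $\bar A_{t-1}$ is an antisymmetric integer $n\times n$ matrix whose $(i,j)$ entry is the net amount lent by $i$ to $j$ at time $t-1$; $\bar A'_{t-1}$ is this matrix after removal of the loans maturing at $t$. Each new loan has size $1$. The net exposure matrix formed by a matching $\mu_t$ is $\bar A_t=\bar A'_{t-1}+\sum_{i\in\mathcal{L}_t,\,\mu_t(i)\ne i}\mathbf{1}_{\{i,\mu_t(i)\}}-\sum_{j\in\mathcal{B}_t,\,\mu_t(j)\ne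 j}\mathbf{1}_{\{j,\mu_t(j)\}}$, where $\mathbf{1}_{\{a,b\}}$ is the matrix with a single $1$ in position $(a,b)$ and zeros elsewhere. **Insolvency cascade and expected systemic loss.** $\vec E_t=(E^1_t,\dots,E^n_t)$ with $E_t^i>0$ are the banks' equities. Given an initially bankrupt bank $k$, set $E^k(0)=0$, $E^i(0)=E^i_t$ for $i\ne k$, $\sigma^i(0)=H$, $\theta^i(0)=0$ for all $i$, and for $\delta\ge1$ $$E^i(\delta)=\max\Big(0,\;E^i(\delta-1)-\sum_{j:\,\sigma^j(\delta-1)=F,\ \bar A^{ij}_t>0}\bar A^{ij}_t\Big),$$ $\sigma^i(\delta)=F$ if $E^i(\delta)=0$ and $\sigma^i(\delta-1)=H$; $\sigma^i(\delta)=H$ if $E^i(\delta)>0$; $\sigma^i(\delta)=I$ if $\sigma^i(\delta-1)\in\{F,I\}$; and $\theta^i(\delta)=1$ if $\sigma^i(\delta)=F$ or $\theta^i(\delta-1)=1$, else $0$. The dynamics stop after finitely many steps $\bar\delta$. The systemic impact of $k$ is $SI^k(\bar A_t,\vec E_t)=\sum_{j\ne k}\mathbf{1}\{\theta^j(\bar\delta)=1\}E^j_t$ for the cascade started from $k$. With hazard rates $\gamma^j$ of exogenous default, $\gamma^{agg}=\sum_{j}\gamma^j$ and $\bar\rho^j_1=(1-e^{-\gamma^{agg}})\gamma^j/\gamma^{agg}$ (probability that $j$ is the first bank to go bankrupt exogenously over the next period), the expected systemic loss is $ESL(\bar A_t,\vec E_t)=\sum_{j=1}^n\bar\rho^j_1\,SI^j(\bar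 A_t,\vec E_t)$. **Systemic risk-efficiency.** $\overline{\mathcal{EQ}}_t$ is the set of matchings with $r_i<\bar r_j$ for all $\mu_t(i)=j$, $i\in\mathcal{L}_t$, $j\in\mathcal{B}_t$. For a trading volume $\nu$, an equilibrium matching is systemic risk-efficient if it belongs to the argmin of $ESL(\bar A_t,\vec E_t)$ over $\{\mu_t\in\overline{\mathcal{EQ}}_t:\mathrm{Vol}(\mu_t)=\nu\}$, where $\bar A_t$ is the net exposure matrix formed by $\mu_t$. *)

theory Defs
  imports "HOL-Analysis.Finite_Cartesian_Product"
begin

text \<open>Banks are the elements of a finite type \<open>'n\<close>.\<close>

record 'n market =
  lenders :: "'n set"
  borrowers :: "'n set"
  lend_rate :: "'n \<Rightarrow> real"
  res_rate :: "'n \<Rightarrow> real"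
  def_prob :: "'n \<Rightarrow> real"

definition is_market :: "'n::finite market \<Rightarrow> bool" where
  "is_market M \<longleftrightarrow> lenders M \<inter> borrowers M = {} \<and>
     (\<forall>j\<in>borrowers M. 0 \<le> def_prob M j \<and> def_prob M j \<le> 1)"

text \<open>A rate function \<open>R\<close> gives the rate \<open>R i j\<close> that borrower \<open>j\<close> pays to lender \<open>i\<close>.
  All notions of preference and stability below are relative to such an \<open>R\<close>.\<close>

definition untaxed_rate :: "'n::finite market \<Rightarrow> 'n \<Rightarrow> 'n \<Rightarrow> real" where
  "untaxed_rate M i j = lend_rate M i"

definition srt_rate :: "'n::finite market \<Rightarrow> ('n \<Rightarrow> 'n \<Rightarrow> real) \<Rightarrow> 'n \<Rightarrow> 'n \<Rightarrow> real" where
  "srt_rate M T i j = lend_rate M i + T i j"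

definition tobin_rate :: "'n::finite market \<Rightarrow> real \<Rightarrow> 'n \<Rightarrow> 'n \<Rightarrow> real" where
  "tobin_rate M \<kappa> i j = lend_rate M i + \<kappa>"

definition systemic_risk_tax :: "'n::finite market \<Rightarrow> ('n \<Rightarrow> 'n \<Rightarrow> real) \<Rightarrow> bool" where
  "systemic_risk_tax M T \<longleftrightarrow> (\<forall>i\<in>lenders M. \<forall>j\<in>borrowers M. 0 \<le> T i j)"

text \<open>The options of borrower \<open>j\<close> are the lenders and \<open>j\<close> itself (staying unmatched).\<close>

definition option_rate ::
    "'n::finite market \<Rightarrow> ('n \<Rightarrow> 'n \<Rightarrow> real) \<Rightarrow> 'n \<Rightarrow> 'n \<Rightarrow> real" where
  "option_rate M R j a = (if a = j then res_rate M j else R a j)"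

definition borrower_prefers ::
    "'n::finite market \<Rightarrow> ('n \<Rightarrow> 'n \<Rightarrow> real) \<Rightarrow> 'n \<Rightarrow> 'n \<Rightarrow> 'n \<Rightarrow> bool" where
  "borrower_prefers M R j a b \<longleftrightarrow> option_rate M R j a < option_rate M R j b"

text \<open>All lenders share the same preference list, so the lender is not an argument.\<close>

definition lender_prefers :: "'n::finite market \<Rightarrow> 'n \<Rightarrow> 'n \<Rightarrow> bool" where
  "lender_prefers M j k \<longleftrightarrow> def_prob M j < def_prob M k"

definition lender_indifferent :: "'n::finite market \<Rightarrow> 'n \<Rightarrow> 'n \<Rightarrow> bool" where
  "lender_indifferent M j k \<longleftrightarrow> def_prob M j = def_prob M k"

definition strict_lender_preferences :: "'n::finite market \<Rightarrow> bool" where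
  "strict_lender_preferences M \<longleftrightarrow> inj_on (def_prob M) (borrowers M)"

definition strict_preferences ::
    "'n::finite market \<Rightarrow> ('n \<Rightarrow> 'n \<Rightarrow> real) \<Rightarrow> bool" where
  "strict_preferences M R \<longleftrightarrow> strict_lender_preferences M \<and>
     (\<forall>j\<in>borrowers M. inj_on (option_rate M R j) (insert j (lenders M)))"

definition is_matching :: "'n::finite market \<Rightarrow> ('n \<Rightarrow> 'n) \<Rightarrow> bool" where
  "is_matching M \<mu> \<longleftrightarrow> bij \<mu> \<and> (\<forall>a. \<mu> (\<mu> a) = a) \<and>
     (\<forall>b\<in>borrowers M. \<mu> b \<noteq> b \<longrightarrow> \<mu> b \<in> lenders M) \<and>
     (\<forall>l\<in>lenders M. \<mu> l \<noteq> l \<longrightarrow> \<mu> l \<in> borrowers M)"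

definition volume :: "'n::finite market \<Rightarrow> ('n \<Rightarrow> 'n) \<Rightarrow> real" where
  "volume M \<mu> = 1/2 * (\<Sum>i\<in>lenders M \<union> borrowers M. of_bool (\<mu> i \<noteq> i))"

definition no_pairwise_deviation ::
    "'n::finite market \<Rightarrow> ('n \<Rightarrow> 'n \<Rightarrow> real) \<Rightarrow> ('n \<Rightarrow> 'n) \<Rightarrow> bool" where
  "no_pairwise_deviation M R \<mu> \<longleftrightarrow>
     (\<forall>i\<in>lenders M. \<forall>l\<in>lenders M. \<forall>k\<in>borrowers M. \<forall>j\<in>borrowers M.
        \<mu> i = j \<and> \<mu> k = l \<longrightarrow> \<not> (lender_prefers M k j \<and> borrower_prefers M R k i l))"

text \<open>The coalition consists of matched borrowers (they have assigned lenders) and is nonempty,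
  since for the empty one the preference condition on the other matching would be void.\<close>

definition no_coalitional_deviation ::
    "'n::finite market \<Rightarrow> ('n \<Rightarrow> 'n \<Rightarrow> real) \<Rightarrow> ('n \<Rightarrow> 'n) \<Rightarrow> bool" where
  "no_coalitional_deviation M R \<mu> \<longleftrightarrow>
     (\<forall>S. S \<subseteq> borrowers M \<and> S \<noteq> {} \<and> (\<forall>j\<in>S. \<mu> j \<noteq> j) \<and>
          (\<forall>j\<in>S. \<forall>k\<in>S. lender_indifferent M j k) \<longrightarrow>
        \<not> (\<exists>\<mu>'. is_matching M \<mu>' \<and> \<mu>' \<noteq> \<mu> \<and>
              (\<forall>j\<in>S. borrower_prefers M R j (\<mu>' j) (\<mu> j))))"

definition no_unilateral_deviation ::
    "'n::finite market \<Rightarrow> ('n \<Rightarrow> 'n \<Rightarrow> real) \<Rightarrow> ('n \<Rightarrow> 'n) \<Rightarrow> bool" where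
  "no_unilateral_deviation M R \<mu> \<longleftrightarrow>
     (\<forall>j\<in>borrowers M. \<mu> j \<noteq> j \<longrightarrow> \<not> borrower_prefers M R j j (\<mu> j)) \<and>
     (\<forall>j\<in>borrowers M. \<not> (\<exists>k\<in>lenders M. \<mu> k = k \<and> borrower_prefers M R j k (\<mu> j)))"

text \<open>Coalitional deviations model swaps between borrowers among whom the lenders are
  indifferent. Under strict lender preferences there are no such swaps and the condition does not
  apply; the guard is needed because a single borrower would still pass the indifference test.\<close>

definition stable_matching ::
    "'n::finite market \<Rightarrow> ('n \<Rightarrow> 'n \<Rightarrow> real) \<Rightarrow> ('n \<Rightarrow> 'n) \<Rightarrow> bool" where
  "stable_matching M R \<mu> \<longleftrightarrow> is_matching M \<mu> \<and> no_pairwise_deviation M R \<mu> \<and>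
     (\<not> strict_lender_preferences M \<longrightarrow> no_coalitional_deviation M R \<mu>) \<and>
     no_unilateral_deviation M R \<mu>"

text \<open>Uniqueness is meant on the market participants: a matching may permute the banks that are
  neither lenders nor borrowers, which affects neither volume nor exposures.\<close>

definition unique_stable ::
    "'n::finite market \<Rightarrow> ('n \<Rightarrow> 'n \<Rightarrow> real) \<Rightarrow> ('n \<Rightarrow> 'n) \<Rightarrow> bool" where
  "unique_stable M R \<mu> \<longleftrightarrow> stable_matching M R \<mu> \<and>
     (\<forall>\<mu>'. stable_matching M R \<mu>' \<longrightarrow> (\<forall>a\<in>lenders M \<union> borrowers M. \<mu>' a = \<mu> a))"

definition antisymmetric_matrix :: "int ^ 'n::finite ^ 'n \<Rightarrow> bool" where
  "antisymmetric_matrix A \<longleftrightarrow> (\<forall>i j. A $ i $ j = - A $ j $ i)"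

text \<open>\<open>D $ i $ j\<close> is the gross amount lent by \<open>i\<close> to \<open>j\<close> that matures at the current date.\<close>

definition remove_maturing :: "int ^ 'n::finite ^ 'n \<Rightarrow> nat ^ 'n ^ 'n \<Rightarrow> int ^ 'n ^ 'n" where
  "remove_maturing A D = (\<chi> i j. A $ i $ j - (int (D $ i $ j) - int (D $ j $ i)))"

definition unit_matrix :: "'n::finite \<Rightarrow> 'n \<Rightarrow> int ^ 'n ^ 'n" where
  "unit_matrix a b = (\<chi> i j. of_bool (i = a \<and> j = b))"

definition net_exposure ::
    "'n::finite market \<Rightarrow> int ^ 'n ^ 'n \<Rightarrow> nat ^ 'n ^ 'n \<Rightarrow> ('n \<Rightarrow> 'n) \<Rightarrow> int ^ 'n ^ 'n" where
  "net_exposure M A D \<mu> = remove_maturing A D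
     + (\<Sum>i\<in>{i \<in> lenders M. \<mu> i \<noteq> i}. unit_matrix i (\<mu> i))
     - (\<Sum>j\<in>{j \<in> borrowers M. \<mu> j \<noteq> j}. unit_matrix j (\<mu> j))"

datatype status = Healthy | Failed | Inactive

record 'n cascade_state =
  equity :: "'n \<Rightarrow> real"
  status_of :: "'n \<Rightarrow> status"
  theta :: "'n \<Rightarrow> nat"

definition cascade_init :: "('n::finite \<Rightarrow> real) \<Rightarrow> 'n \<Rightarrow> 'n cascade_state" where
  "cascade_init E k = \<lparr> equity = E(k := 0), status_of = (\<lambda>_. Healthy), theta = (\<lambda>_. 0) \<rparr>"

text \<open>Equities never increase and are \<open>0\<close> from the time of failure on, so along a cascade the
  three cases for the new status are mutually exclusive and their order is immaterial.\<close>

definition cascade_step :: "int ^ 'n::finite ^ 'n \<Rightarrow> 'n cascade_state \<Rightarrow> 'n cascade_state" where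
  "cascade_step A s =
     (let e = (\<lambda>i. max 0 (equity s i - (\<Sum>j\<in>{j. status_of s j = Failed \<and> A $ i $ j > 0}. real_of_int (A $ i $ j))));
          \<sigma> = (\<lambda>i. if e i > 0 then Healthy else if status_of s i = Healthy then Failed else Inactive)
      in \<lparr> equity = e, status_of = \<sigma>, theta = (\<lambda>i. if \<sigma> i = Failed \<or> theta s i = 1 then 1 else 0) \<rparr>)"

definition cascade ::
    "int ^ 'n::finite ^ 'n \<Rightarrow> ('n \<Rightarrow> real) \<Rightarrow> 'n \<Rightarrow> nat \<Rightarrow> 'n cascade_state" where
  "cascade A E k d = (cascade_step A ^^ d) (cascade_init E k)"

text \<open>The time at which the dynamics stop; it exists by \<open>cascade_stops\<close> below.\<close>

definition cascade_end :: "int ^ 'n::finite ^ 'n \<Rightarrow> ('n \<Rightarrow> real) \<Rightarrow> 'n \<Rightarrow> nat" where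
  "cascade_end A E k = (LEAST d. cascade A E k (Suc d) = cascade A E k d)"

definition systemic_impact :: "int ^ 'n::finite ^ 'n \<Rightarrow> ('n \<Rightarrow> real) \<Rightarrow> 'n \<Rightarrow> real" where
  "systemic_impact A E k =
     (\<Sum>j\<in>UNIV - {k}. of_bool (theta (cascade A E k (cascade_end A E k)) j = 1) * E j)"

definition first_default_prob :: "('n::finite \<Rightarrow> real) \<Rightarrow> 'n \<Rightarrow> real" where
  "first_default_prob \<gamma> j = (1 - exp (- (\<Sum>i\<in>UNIV. \<gamma> i))) * \<gamma> j / (\<Sum>i\<in>UNIV. \<gamma> i)"

definition ESL :: "('n::finite \<Rightarrow> real) \<Rightarrow> int ^ 'n ^ 'n \<Rightarrow> ('n \<Rightarrow> real) \<Rightarrow> real" where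
  "ESL \<gamma> A E = (\<Sum>j\<in>UNIV. first_default_prob \<gamma> j * systemic_impact A E j)"

definition EQ_bar :: "'n::finite market \<Rightarrow> ('n \<Rightarrow> 'n) set" where
  "EQ_bar M = {\<mu>. is_matching M \<mu> \<and>
     (\<forall>i\<in>lenders M. \<forall>j\<in>borrowers M. \<mu> i = j \<longrightarrow> lend_rate M i < res_rate M j)}"

definition systemic_risk_efficient ::
    "'n::finite market \<Rightarrow> ('n \<Rightarrow> real) \<Rightarrow> int ^ 'n ^ 'n \<Rightarrow> nat ^ 'n ^ 'n \<Rightarrow> ('n \<Rightarrow> real) \<Rightarrow>
      real \<Rightarrow> ('n \<Rightarrow> 'n) \<Rightarrow> bool" where
  "systemic_risk_efficient M \<gamma> A D E \<nu> \<mu> \<longleftrightarrow>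
     is_arg_min (\<lambda>\<mu>'. ESL \<gamma> (net_exposure M A D \<mu>') E)
       (\<lambda>\<mu>'. \<mu>' \<in> EQ_bar M \<and> volume M \<mu>' = \<nu>) \<mu>"

lemma cascade_Suc: "cascade A E k (Suc d) = cascade_step A (cascade A E k d)"
  by (simp add: cascade_def)

lemma cascade_invariants:
  assumes "\<forall>i. 0 < E i"
  shows "0 \<le> equity (cascade A E k d) i \<and> theta (cascade A E k d) i \<in> {0, 1} \<and>
    (status_of (cascade A E k d) i \<noteq> Healthy \<longrightarrow> equity (cascade A E k d) i = 0)"
proof (induction d arbitrary: i)
  case 0
  then show ?case using assms by (auto simp: cascade_def cascade_init_def less_imp_le)
next
  case (Suc d)
  then show ?case by (auto simp: cascade_Suc cascade_step_def Let_def)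
qed

definition status_rank :: "status \<Rightarrow> nat" where
  "status_rank x = (case x of Healthy \<Rightarrow> 0 | Failed \<Rightarrow> 1 | Inactive \<Rightarrow> 2)"

lemma cascade_stops:
  assumes pos: "\<forall>i. 0 < E i"
  shows "\<exists>d. cascade A E k (Suc d) = cascade A E k d"
proof (rule ccontr)
  assume "\<not> ?thesis"
  then have neq: "cascade A E k (Suc d) \<noteq> cascade A E k d" for d by blast
  let ?c = "cascade A E k"
  let ?rk = "\<lambda>d. \<Sum>i\<in>UNIV. status_rank (status_of (?c d) i)"
  have eqS: "equity (?c (Suc d)) i = max 0 (equity (?c d) i -
      (\<Sum>j\<in>{j. status_of (?c d) j = Failed \<and> A $ i $ j > 0}. real_of_int (A $ i $ j)))" for d i
    by (simp add: cascade_Suc cascade_step_def Let_def)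
  have stS: "status_of (?c (Suc d)) i = (if equity (?c (Suc d)) i > 0 then Healthy
      else if status_of (?c d) i = Healthy then Failed else Inactive)" for d i
    by (simp only: cascade_Suc cascade_step_def Let_def cascade_state.simps)
  have thS: "theta (?c (Suc d)) i =
      (if status_of (?c (Suc d)) i = Failed \<or> theta (?c d) i = 1 then 1 else 0)" for d i
    by (simp only: cascade_Suc cascade_step_def Let_def cascade_state.simps)
  have adv: "status_of (?c (Suc d)) i = (case status_of (?c d) i of
        Healthy \<Rightarrow> (if equity (?c (Suc d)) i > 0 then Healthy else Failed)
      | Failed \<Rightarrow> Inactive | Inactive \<Rightarrow> Inactive)" for d i
  proof -
    have "(\<Sum>j\<in>{j. status_of (?c d) j = Failed \<and> A $ i $ j > 0}. real_of_int (A $ i $ j)) \<ge> 0"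
      by (rule sum_nonneg) simp
    moreover have "status_of (?c d) i \<noteq> Healthy \<Longrightarrow> equity (?c d) i = 0"
      using cascade_invariants[OF pos, of A k d i] by blast
    ultimately have "status_of (?c d) i \<noteq> Healthy \<Longrightarrow> equity (?c (Suc d)) i = 0"
      using eqS[of d i] by linarith
    then show ?thesis
      using stS[of d i] by (cases "status_of (?c d) i") simp_all
  qed
  have mono: "status_rank (status_of (?c d) i) \<le> status_rank (status_of (?c (Suc d)) i)" for d i
    using adv[of d i] by (cases "status_of (?c d) i") (auto simp: status_rank_def)
  have chg: "\<exists>i. status_of (?c (Suc d)) i \<noteq> status_of (?c d) i" for d
  proof (rule ccontr)
    assume "\<not> ?thesis"
    then have same: "status_of (?c (Suc d)) i = status_of (?c d) i" for i by blast
    have noF: "status_of (?c d) i \<noteq> Failed" for i using adv[of d i] same[of i] by (cases "status_of (?c d) i") simp_all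
    have e: "equity (?c (Suc d)) i = equity (?c d) i" for i
      using noF cascade_invariants[OF pos, of A k d i] by (simp add: eqS)
    have t: "theta (?c (Suc d)) i = theta (?c d) i" for i
      using thS[of d i] noF[of i] same[of i] cascade_invariants[OF pos, of A k d i] by auto
    have "?c (Suc d) = ?c d"
      using ext[of _ _, OF same] ext[of _ _, OF e] ext[of _ _, OF t]
      by (intro cascade_state.equality) simp_all
    with neq show False by blast
  qed
  have strict: "?rk d < ?rk (Suc d)" for d
  proof -
    obtain i where i: "status_of (?c (Suc d)) i \<noteq> status_of (?c d) i" using chg by blast
    have "status_rank (status_of (?c d) i) < status_rank (status_of (?c (Suc d)) i)"
      using adv[of d i] i
      by (cases "status_of (?c d) i") (auto simp: status_rank_def split: if_splits)
    then show ?thesis using mono by (intro sum_strict_mono_ex1) auto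
  qed
  have low: "d \<le> ?rk d" for d
  proof (induction d)
    case (Suc d)
    then show ?case using strict[of d] by linarith
  qed simp
  have up: "?rk d \<le> 2 * card (UNIV :: 'a set)" for d
    using sum_bounded_above[of UNIV "\<lambda>i. status_rank (status_of (?c d) i)" 2]
    by (auto simp: status_rank_def mult.commute split: status.splits)
  show False using low[of "Suc (2 * card (UNIV :: 'a set))"] up[of "Suc (2 * card (UNIV :: 'a set))"]
    by linarith
qed

end

theory Submission
  imports Defs
begin

text \<open>A tax that is zero on the pairs of a given matching and prohibitively high on all other pairs
  leaves each borrower with its own partner as the only acceptable lender. Hence every matching in
  which all trades are profitable without tax is the unique stable matching for some tax. Stable
  matchings without tax or with a Tobin-like tax are of this kind, and so are the minimisers of the
  expected systemic loss.\<close>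

text \<open>A surcharge large enough to lift every lending rate above every reservation rate. Rates
  may have either sign, hence the absolute values; the final 1 makes the comparison strict.\<close>

definition prohibitive :: "'n::finite market \<Rightarrow> real" where
  "prohibitive M = (\<Sum>a\<in>UNIV. \<bar>res_rate M a\<bar>) + (\<Sum>a\<in>UNIV. \<bar>lend_rate M a\<bar>) + 1"

lemma prohibitive_nonneg: "0 \<le> prohibitive M"
  unfolding prohibitive_def by (intro add_nonneg_nonneg sum_nonneg) auto

lemma res_rate_less_prohibitive: "res_rate M j < lend_rate M i + prohibitive M"
proof -
  have "\<bar>res_rate M j\<bar> \<le> (\<Sum>a\<in>UNIV. \<bar>res_rate M a\<bar>)"
    "\<bar>lend_rate M i\<bar> \<le> (\<Sum>a\<in>UNIV. \<bar>lend_rate M a\<bar>)"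
    by (rule member_le_sum; simp)+
  then show ?thesis
    unfolding prohibitive_def by linarith
qed

definition supporting_tax :: "'n::finite market \<Rightarrow> ('n \<Rightarrow> 'n) \<Rightarrow> 'n \<Rightarrow> 'n \<Rightarrow> real" where
  "supporting_tax M \<mu> i j = (if \<mu> j = i then 0 else prohibitive M)"

lemma systemic_risk_tax_supporting_tax: "systemic_risk_tax M (supporting_tax M \<mu>)"
  by (simp add: systemic_risk_tax_def supporting_tax_def prohibitive_nonneg)

context
  fixes M :: "'n::finite market" and \<mu> :: "'n \<Rightarrow> 'n" and R :: "'n \<Rightarrow> 'n \<Rightarrow> real"
  assumes market: "is_market M"
    and eq: "\<mu> \<in> EQ_bar M"
    and strict: "strict_preferences M (untaxed_rate M)"
  defines "R \<equiv> srt_rate M (supporting_tax M \<mu>)"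
begin

lemma matching: "is_matching M \<mu>"
  using eq by (simp add: EQ_bar_def)

lemma lender_not_borrower: "i \<in> lenders M \<Longrightarrow> i \<notin> borrowers M"
  using market by (auto simp: is_market_def)

lemma partner_rate_less:
  assumes "j \<in> borrowers M" "\<mu> j \<noteq> j"
  shows "R (\<mu> j) j < res_rate M j"
proof -
  have "\<mu> j \<in> lenders M" "\<mu> (\<mu> j) = j"
    using matching assms by (auto simp: is_matching_def)
  then show ?thesis
    using eq assms(1) by (auto simp: EQ_bar_def R_def srt_rate_def supporting_tax_def)
qed

lemma other_rate_greater: "\<mu> j \<noteq> i \<Longrightarrow> res_rate M j < R i j"
  by (simp add: R_def srt_rate_def supporting_tax_def res_rate_less_prohibitive)

text \<open>The reservation rate separates the options: a matched borrower's partner lies strictly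
  below it, all other lenders strictly above. Those others are shifted by one common constant, so
  they stay distinct because they are distinct without tax.\<close>

lemma strict_preferences_supporting_tax: "strict_preferences M R"
  unfolding strict_preferences_def
proof (intro conjI ballI inj_onI)
  show "strict_lender_preferences M"
    using strict by (simp add: strict_preferences_def)
next
  fix j a b
  assume j: "j \<in> borrowers M" and a: "a \<in> insert j (lenders M)" and b: "b \<in> insert j (lenders M)"
    and e: "option_rate M R j a = option_rate M R j b"
  have inj: "inj_on (option_rate M (untaxed_rate M) j) (insert j (lenders M))"
    using strict j by (simp add: strict_preferences_def)
  have cmp: "option_rate M R j c < res_rate M j \<longleftrightarrow> c \<noteq> j \<and> \<mu> j = c"
    "option_rate M R j c = res_rate M j \<longleftrightarrow> c = j" for c
    using partner_rate_less[OF j] other_rate_greater[of j c]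
    by (cases "\<mu> j = c"; force simp: option_rate_def)+
  show "a = b"
  proof (cases "a = j \<or> b = j \<or> \<mu> j = a \<or> \<mu> j = b")
    case True
    then show ?thesis
      using cmp[of a] cmp[of b] e by metis
  next
    case False
    then have "option_rate M (untaxed_rate M) j a = option_rate M (untaxed_rate M) j b"
      using e by (auto simp: option_rate_def R_def srt_rate_def supporting_tax_def untaxed_rate_def)
    then show ?thesis
      using inj a b by (metis inj_onD)
  qed
qed

lemma stable_matching_supporting_tax: "stable_matching M R \<mu>"
  unfolding stable_matching_def
proof (intro conjI impI)
  show "is_matching M \<mu>"
    by (rule matching)
  show "no_coalitional_deviation M R \<mu>" if "\<not> strict_lender_preferences M"
    using that strict by (simp add: strict_preferences_def)
  \<comment> \<open>Each borrower already holds its best option. Pairwise and unilateral deviations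
    both need a borrower who gains, so neither can occur, whatever the lenders want.\<close>
  have best: "\<not> borrower_prefers M R j i (\<mu> j)" if "j \<in> borrowers M" for i j
    using partner_rate_less[OF that] other_rate_greater[of j i]
    by (cases "\<mu> j = i"; cases "\<mu> j = j") (auto simp: borrower_prefers_def option_rate_def)
  then show "no_pairwise_deviation M R \<mu>" "no_unilateral_deviation M R \<mu>"
    by (auto simp: no_pairwise_deviation_def no_unilateral_deviation_def)
qed

text \<open>Unilateral deviations alone force this. A borrower matched to a lender other than its
  partner under \<open>\<mu>\<close> would rather stay unmatched. A borrower left unmatched despite
  having a partner under \<open>\<mu>\<close> would find that lender idle and take it.\<close>

lemma stable_matching_supporting_tax_eq:
  assumes "stable_matching M R \<mu>'" and a: "a \<in> lenders M \<union> borrowers M"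
  shows "\<mu>' a = \<mu> a"
proof -
  have m': "is_matching M \<mu>'" and u: "no_unilateral_deviation M R \<mu>'"
    using assms(1) by (auto simp: stable_matching_def)
  have partner: "\<mu>' j = \<mu> j" if "j \<in> borrowers M" "\<mu>' j \<noteq> j" for j
  proof (rule ccontr)
    assume "\<mu>' j \<noteq> \<mu> j"
    then have "borrower_prefers M R j j (\<mu>' j)"
      using other_rate_greater[of j "\<mu>' j"] that by (auto simp: borrower_prefers_def option_rate_def)
    then show False
      using u that by (auto simp: no_unilateral_deviation_def)
  qed
  have borrower: "\<mu>' j = \<mu> j" if j: "j \<in> borrowers M" for j
  proof (cases "\<mu>' j = j \<and> \<mu> j \<noteq> j")
    case True
    have l: "\<mu> j \<in> lenders M" and inv: "\<mu> (\<mu> j) = j"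
      using matching j True by (auto simp: is_matching_def)
    \<comment> \<open>A borrower \<open>k\<close> holding this lender under \<open>\<mu>'\<close>
      would have to be matched as under \<open>\<mu>\<close>, which assigns the lender to
      \<open>j\<close> only.\<close>
    have "\<mu>' (\<mu> j) = \<mu> j"
    proof (rule ccontr)
      assume n: "\<mu>' (\<mu> j) \<noteq> \<mu> j"
      define k where "k = \<mu>' (\<mu> j)"
      have k: "k \<in> borrowers M" "\<mu>' k = \<mu> j"
        using m' l n by (auto simp: is_matching_def k_def)
      then have "\<mu> k = \<mu> j"
        using partner[of k] lender_not_borrower[OF l] by metis
      then have "k = j"
        using matching inv by (metis is_matching_def)
      then show False
        using k True by simp
    qed
    moreover have "borrower_prefers M R j (\<mu> j) (\<mu>' j)"
      using partner_rate_less[OF j] True by (simp add: borrower_prefers_def option_rate_def)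
    ultimately show ?thesis
      using u j l by (auto simp: no_unilateral_deviation_def)
  qed (use partner j in metis)
  show ?thesis
  proof (cases "a \<in> borrowers M")
    case False
    then have l: "a \<in> lenders M"
      using a by blast
    \<comment> \<open>Agreement passes from borrowers to lenders: a partner of \<open>a\<close>
      under either matching is a borrower, where the two agree, and both are involutions.\<close>
    then have "\<mu>' a \<noteq> a \<Longrightarrow> \<mu>' a \<in> borrowers M" "\<mu> a \<noteq> a \<Longrightarrow> \<mu> a \<in> borrowers M"
      using m' matching by (auto simp: is_matching_def)
    then show ?thesis
      using borrower m' matching by (metis is_matching_def)
  qed (rule borrower)
qed

end

text \<open>Reduces each claim about taxes to finding a suitable member of
  \<open>EQ_bar M\<close>.\<close>

lemma EQ_bar_implementable:
  assumes "is_market M" "\<mu> \<in> EQ_bar M" "strict_preferences M (untaxed_rate M)"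
  shows "\<exists>T. systemic_risk_tax M T \<and> strict_preferences M (srt_rate M T) \<and>
    unique_stable M (srt_rate M T) \<mu>"
  using systemic_risk_tax_supporting_tax strict_preferences_supporting_tax[OF assms]
    stable_matching_supporting_tax[OF assms] stable_matching_supporting_tax_eq[OF assms]
  unfolding unique_stable_def by metis

text \<open>No borrower prefers leaving its match, so the taxed rate is at most the reservation
  rate, and the untaxed rate all the more. Equality would be a tie in the untaxed preference
  list.\<close>

lemma stable_tobin_in_EQ_bar:
  assumes "strict_preferences M (untaxed_rate M)" "0 \<le> \<kappa>" "is_market M"
    and st: "stable_matching M (tobin_rate M \<kappa>) \<mu>"
  shows "\<mu> \<in> EQ_bar M"
  unfolding EQ_bar_def
proof (intro CollectI conjI ballI impI)
  show m: "is_matching M \<mu>"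
    using st by (simp add: stable_matching_def)
  fix i j
  assume i: "i \<in> lenders M" and j: "j \<in> borrowers M" and "\<mu> i = j"
  then have p: "\<mu> j = i" and ne: "i \<noteq> j"
    using m assms(3) by (auto simp: is_matching_def is_market_def)
  have "\<not> borrower_prefers M (tobin_rate M \<kappa>) j j i"
    using st j p ne by (auto simp: stable_matching_def no_unilateral_deviation_def)
  then have "lend_rate M i + \<kappa> \<le> res_rate M j"
    using ne by (simp add: borrower_prefers_def option_rate_def tobin_rate_def)
  moreover have "lend_rate M i \<noteq> res_rate M j"
  proof
    assume "lend_rate M i = res_rate M j"
    then have "option_rate M (untaxed_rate M) j i = option_rate M (untaxed_rate M) j j"
      using ne by (simp add: option_rate_def untaxed_rate_def)
    then show False
      using assms(1) i j ne unfolding strict_preferences_def by (metis inj_onD insertCI)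
  qed
  ultimately show "lend_rate M i < res_rate M j"
    using assms(2) by linarith
qed

text \<open>A finite set of banks has only finitely many matchings, and \<open>\<mu>\<close> shows
  that some have the required volume, so the minimum is attained.\<close>

lemma systemic_risk_efficient_exists:
  assumes "\<mu> \<in> EQ_bar M" "volume M \<mu> = \<nu>"
  shows "\<exists>\<mu>'. \<mu>' \<in> EQ_bar M \<and> systemic_risk_efficient M \<gamma> A D E \<nu> \<mu>'"
proof -
  let ?f = "\<lambda>\<mu>'. ESL \<gamma> (net_exposure M A D \<mu>') E"
  obtain \<mu>' where "is_arg_min ?f (\<lambda>x. x \<in> {x \<in> EQ_bar M. volume M x = \<nu>}) \<mu>'"
    using ex_is_arg_min_if_finite[of "{x \<in> EQ_bar M. volume M x = \<nu>}" ?f] assms by auto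
  then show ?thesis
    by (auto simp: systemic_risk_efficient_def is_arg_min_def)
qed

theorem proposition5:
  fixes M :: "'n::finite market"
    and A_prev :: "int ^ 'n ^ 'n" and D :: "nat ^ 'n ^ 'n"
    and E \<gamma> :: "'n \<Rightarrow> real"
    and \<kappa> \<nu> :: real
    and \<mu>_star \<mu>_tobin :: "'n \<Rightarrow> 'n"
  assumes "is_market M"
    and "strict_preferences M (untaxed_rate M)"
    and "antisymmetric_matrix A_prev"
    and "\<forall>i. 0 < E i"
    and "\<forall>j. 0 \<le> \<gamma> j"
    and "0 \<le> \<kappa>"
    and "stable_matching M (untaxed_rate M) \<mu>_star"
    and "stable_matching M (tobin_rate M \<kappa>) \<mu>_tobin"
  shows "(volume M \<mu>_star = \<nu> \<longrightarrow>
            (\<exists>T \<mu>_T. systemic_risk_tax M T \<and> strict_preferences M (srt_rate M T) \<and>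
               unique_stable M (srt_rate M T) \<mu>_T \<and>
               ESL \<gamma> (net_exposure M A_prev D \<mu>_T) E \<le> ESL \<gamma> (net_exposure M A_prev D \<mu>_star) E \<and>
               volume M \<mu>_T \<ge> volume M \<mu>_star) \<and>
            (\<exists>T \<mu>_T. systemic_risk_tax M T \<and> strict_preferences M (srt_rate M T) \<and>
               unique_stable M (srt_rate M T) \<mu>_T \<and>
               systemic_risk_efficient M \<gamma> A_prev D E \<nu> \<mu>_T)) \<and>
         (volume M \<mu>_tobin = \<nu> \<longrightarrow>
            (\<exists>T \<mu>_T. systemic_risk_tax M T \<and> strict_preferences M (srt_rate M T) \<and>
               unique_stable M (srt_rate M T) \<mu>_T \<and>
               ESL \<gamma> (net_exposure M A_prev D \<mu>_T) E \<le> ESL \<gamma> (net_exposure M A_prev D \<mu>_tobin) E \<and>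
               volume M \<mu>_T \<ge> volume M \<mu>_tobin))"
proof -
  \<comment> \<open>The untaxed market is the Tobin case with rate 0, so one lemma covers both
    equilibria.\<close>
  have "untaxed_rate M = tobin_rate M 0"
    by (simp add: fun_eq_iff untaxed_rate_def tobin_rate_def)
  then have star: "\<mu>_star \<in> EQ_bar M"
    using stable_tobin_in_EQ_bar[of M 0] assms by simp
  have tobin: "\<mu>_tobin \<in> EQ_bar M"
    using stable_tobin_in_EQ_bar assms by blast
  note impl = EQ_bar_implementable[OF assms(1) _ assms(2)]
  \<comment> \<open>For both comparisons the tax reproduces the given equilibrium itself, so the
    inequalities hold with equality. For efficiency it implements a minimiser of the expected
    systemic loss instead.\<close>
  show ?thesis
    using impl[OF star] impl[OF tobin] systemic_risk_efficient_exists[OF star] impl by blast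
qed

end
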